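(* Let $R$ be a Noetherian ring, let $v_1,\ldots,v_s$ be discrete valuations of $R$, let $a_1,\ldots,a_s\in\mathbb{R}_{>0}$, and let $\mathcal{I}=\{I_m\}_{m\in\mathbb{N}}$ be the discrete valued filtration of $R$ given by $I_m = I(v_1)_{ma_1}\cap\cdots\cap I(v_s)_{ma_s}$. Then for every $f\in R\setminus\{0\}$, $$\nu_{\mathcal{I}}(f) = \min\left\{\left\lfloor\frac{v_1(f)}{a_1}\right\rfloor,\ldots,\left\lfloor\frac{v_s(f)}{a_s}\right\rfloor\right\}\quad\text{and}\quad \overline{\nu}_{\mathcal{I}}(f) = \min\left\{\frac{v_1(f)}{a_1},\ldots,\frac{v_s(f)}{a_s}\right\}.$$
   Context: Rings are commutative with identity, and $\mathbb{N}$ denotes the nonnegative integers. A filtration of a ring $R$ is a family $\mathcal{I} = \{I_m\}_{m\in\mathbb{N}}$ of ideals of $R$ with $I_0 = R$, $I_n \supseteq I_{n+1}$ and $I_n I_m \subseteq I_{n+m}$ for all $m,n \in \mathbb{N}$. The order of $\mathcal{I}$ is $\nu_{\mathcal{I}}(f) = \sup\{m \mid f \in I_m\} \in \mathbb{N}\cup\{\infty\}$ for $f \in R$. The asymptotic Samuel function of $\mathcal{I}$ is $\overline{\nu}_{\mathcal{I}} : R \to \mathbb{R}_{\ge 0}\cup\{\infty\}$, $\overline{\nu}_{\mathcal{I}}(x) = \lim_{n\to\infty} \nu_{\mathcal{I}}(x^n)/n$ (this limit always exists in $\mathbb{R}_{\ge 0}\cup\{\infty\}$). A discrete valuation of $R$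 is a map $v: R\to\mathbb{Z}\cup\{\infty\}$ obtained as follows: there are a minimal prime $P$ of $R$ and a rank 1 discrete valuation $v$ of the quotient field $\kappa(P)$ of $R/P$, with value group identified with $\mathbb{Z}$ (so $v$ is surjective from $\kappa(P)^{\times}$ onto $\mathbb{Z}$), nonnegative on $R/P$; for $r\in R$ set $v(r)$ to be the value of the image of $r$ in $R/P$ if $r\notin P$, and $v(r)=\infty$ if $r\in P$. For $c\in\mathbb{R}_{\ge0}$, $I(v)_c = \{f\in R\mid v(f)\ge c\}$. A discrete valued filtration of $R$ is a filtration $\{I_m\}_{m\in\mathbb{N}}$ for which there are $s\geq 1$, discrete valuations $v_1,\ldots,v_s$ of $R$ and $a_1,\ldots,a_s\in\mathbb{R}_{>0}$ with $I_m = \bigcap_{i=1}^s I(v_i)_{ma_i}$ for all $m\in\mathbb{N}$. Conventions: $\infty/a=\infty$ for $a\in\mathbb{R}_{>0}$ and $\lfloor\infty\rfloor=\infty$. *)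

theory Defs
  imports
    "HOL-Algebra.Ring_Divisibility"
    "HOL-Algebra.QuotRing"
    "HOL-Algebra.Ideal_Product"
    "HOL-Library.Extended_Real"
begin

section \<open>The quotient field of a domain\<close>

text \<open>Pairs \<open>(a, b)\<close> with \<open>b\<close> nonzero, modulo cross multiplication.\<close>

definition frac_pairs :: "('a, 'm) ring_scheme \<Rightarrow> ('a \<times> 'a) set" where
  "frac_pairs D = carrier D \<times> (carrier D - {\<zero>\<^bsub>D\<^esub>})"

definition frac_rel :: "('a, 'm) ring_scheme \<Rightarrow> (('a \<times> 'a) \<times> ('a \<times> 'a)) set" where
  "frac_rel D = {((a, b), (c, d)). (a, b) \<in> frac_pairs D \<and> (c, d) \<in> frac_pairs D \<and>
     a \<otimes>\<^bsub>D\<^esub> d = c \<otimes>\<^bsub>D\<^esub> b}"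

definition frac :: "('a, 'm) ring_scheme \<Rightarrow> 'a \<Rightarrow> 'a \<Rightarrow> ('a \<times> 'a) set" where
  "frac D a b = frac_rel D `` {(a, b)}"

definition quotient_field :: "('a, 'm) ring_scheme \<Rightarrow> ('a \<times> 'a) set ring" where
  "quotient_field D =
    \<lparr>carrier = frac_pairs D // frac_rel D,
     mult = (\<lambda>X Y. \<Union>(a, b)\<in>X. \<Union>(c, d)\<in>Y. frac D (a \<otimes>\<^bsub>D\<^esub> c) (b \<otimes>\<^bsub>D\<^esub> d)),
     one = frac D \<one>\<^bsub>D\<^esub> \<one>\<^bsub>D\<^esub>,
     zero = frac D \<zero>\<^bsub>D\<^esub> \<one>\<^bsub>D\<^esub>,
     add = (\<lambda>X Y. \<Union>(a, b)\<in>X. \<Union>(c, d)\<in>Y.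
       frac D ((a \<otimes>\<^bsub>D\<^esub> d) \<oplus>\<^bsub>D\<^esub> (c \<otimes>\<^bsub>D\<^esub> b)) (b \<otimes>\<^bsub>D\<^esub> d))\<rparr>"

context "domain"
begin

lemma equiv_frac_rel: "equiv (frac_pairs R) (frac_rel R)"
proof (rule equivI)
  show "frac_rel R \<subseteq> frac_pairs R \<times> frac_pairs R" by (auto simp: frac_rel_def)
  show "refl_on (frac_pairs R) (frac_rel R)"
    by (auto simp: refl_on_def frac_rel_def)
  show "sym (frac_rel R)" by (auto simp: sym_def frac_rel_def)
  show "trans (frac_rel R)"
  proof (rule transI, clarify)
    fix a b c d e f
    assume 1: "((a, b), (c, d)) \<in> frac_rel R" and 2: "((c, d), (e, f)) \<in> frac_rel R"
    have C: "a \<in> carrier R" "b \<in> carrier R" "c \<in> carrier R" "d \<in> carrier R" "d \<noteq> \<zero>"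
      "e \<in> carrier R" "f \<in> carrier R" and e1: "a \<otimes> d = c \<otimes> b" and e2: "c \<otimes> f = e \<otimes> d"
      using 1 2 by (auto simp: frac_rel_def frac_pairs_def)
    have "d \<otimes> (a \<otimes> f) = (a \<otimes> d) \<otimes> f" using C by algebra
    also have "\<dots> = (c \<otimes> f) \<otimes> b" unfolding e1 using C by algebra
    also have "\<dots> = d \<otimes> (e \<otimes> b)" unfolding e2 using C by algebra
    finally have "a \<otimes> f = e \<otimes> b" using C by (simp add: m_lcancel)
    then show "((a, b), (e, f)) \<in> frac_rel R" using 1 2 by (auto simp: frac_rel_def)
  qed
qed

lemma frac_eq_iff:
  assumes "a \<in> carrier R" "b \<in> carrier R - {\<zero>}" "c \<in> carrier R" "d \<in> carrier R - {\<zero>}"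
  shows "frac R a b = frac R c d \<longleftrightarrow> a \<otimes> d = c \<otimes> b"
  using eq_equiv_class_iff[OF equiv_frac_rel, of "(a, b)" "(c, d)"] assms
  by (auto simp: frac_def frac_rel_def frac_pairs_def)

lemma frac_closed [simp]:
  assumes "a \<in> carrier R" "b \<in> carrier R - {\<zero>}"
  shows "frac R a b \<in> carrier (quotient_field R)"
  using assms by (auto simp: quotient_field_def frac_def frac_pairs_def intro!: quotientI)

lemma frac_cases:
  assumes "x \<in> carrier (quotient_field R)"
  obtains a b where "a \<in> carrier R" "b \<in> carrier R - {\<zero>}" "x = frac R a b"
  using assms by (auto simp: quotient_field_def frac_def frac_pairs_def elim!: quotientE)

lemma frac_one [simp]: "\<one>\<^bsub>quotient_field R\<^esub> = frac R \<one> \<one>"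
  and frac_zero [simp]: "\<zero>\<^bsub>quotient_field R\<^esub> = frac R \<zero> \<one>"
  by (simp_all add: quotient_field_def)

lemma mem_frac:
  "(a', b') \<in> frac R a b \<longleftrightarrow> (a, b) \<in> frac_pairs R \<and> (a', b') \<in> frac_pairs R \<and> a \<otimes> b' = a' \<otimes> b"
  by (auto simp: frac_def frac_rel_def)

lemma frac_mult:
  assumes "a \<in> carrier R" "b \<in> carrier R - {\<zero>}" "c \<in> carrier R" "d \<in> carrier R - {\<zero>}"
  shows "frac R a b \<otimes>\<^bsub>quotient_field R\<^esub> frac R c d = frac R (a \<otimes> c) (b \<otimes> d)"
proof -
  have *: "frac R (a' \<otimes> c') (b' \<otimes> d') = frac R (a \<otimes> c) (b \<otimes> d)"
    if "(a', b') \<in> frac R a b" "(c', d') \<in> frac R c d" for a' b' c' d'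
  proof -
    have C: "a' \<in> carrier R" "b' \<in> carrier R - {\<zero>}" "c' \<in> carrier R" "d' \<in> carrier R - {\<zero>}"
      and e1: "a \<otimes> b' = a' \<otimes> b" and e2: "c \<otimes> d' = c' \<otimes> d"
      using that by (auto simp: mem_frac frac_pairs_def)
    note C' = C assms
    have D: "b' \<in> carrier R" "d' \<in> carrier R" "b \<in> carrier R" "d \<in> carrier R" using C' by auto
    have "(a' \<otimes> c') \<otimes> (b \<otimes> d) = (a' \<otimes> b) \<otimes> (c' \<otimes> d)" using C' D by algebra
    also have "\<dots> = (a \<otimes> c) \<otimes> (b' \<otimes> d')"
      unfolding e1[symmetric] e2[symmetric] using C' D by algebra
    finally show ?thesis using C' by (subst frac_eq_iff) (auto simp: integral_iff)
  qed
  have "(a, b) \<in> frac R a b" "(c, d) \<in> frac R c d"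
    using assms by (auto simp: mem_frac frac_pairs_def)
  then show ?thesis unfolding quotient_field_def by (auto dest: * )
qed

lemma frac_add:
  assumes "a \<in> carrier R" "b \<in> carrier R - {\<zero>}" "c \<in> carrier R" "d \<in> carrier R - {\<zero>}"
  shows "frac R a b \<oplus>\<^bsub>quotient_field R\<^esub> frac R c d = frac R ((a \<otimes> d) \<oplus> (c \<otimes> b)) (b \<otimes> d)"
proof -
  have *: "frac R ((a' \<otimes> d') \<oplus> (c' \<otimes> b')) (b' \<otimes> d') = frac R ((a \<otimes> d) \<oplus> (c \<otimes> b)) (b \<otimes> d)"
    if "(a', b') \<in> frac R a b" "(c', d') \<in> frac R c d" for a' b' c' d'
  proof -
    have C: "a' \<in> carrier R" "b' \<in> carrier R - {\<zero>}" "c' \<in> carrier R" "d' \<in> carrier R - {\<zero>}"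
      and e1: "a \<otimes> b' = a' \<otimes> b" and e2: "c \<otimes> d' = c' \<otimes> d"
      using that by (auto simp: mem_frac frac_pairs_def)
    note C' = C assms
    have D: "b' \<in> carrier R" "d' \<in> carrier R" "b \<in> carrier R" "d \<in> carrier R" using C' by auto
    have "((a' \<otimes> d') \<oplus> (c' \<otimes> b')) \<otimes> (b \<otimes> d)
        = (a' \<otimes> b) \<otimes> (d \<otimes> d') \<oplus> (c' \<otimes> d) \<otimes> (b \<otimes> b')" using C' D by algebra
    also have "\<dots> = ((a \<otimes> d) \<oplus> (c \<otimes> b)) \<otimes> (b' \<otimes> d')"
      unfolding e1[symmetric] e2[symmetric] using C' D by algebra
    finally show ?thesis using C' by (subst frac_eq_iff) (auto simp: integral_iff)
  qed
  have "(a, b) \<in> frac R a b" "(c, d) \<in> frac R c d"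
    using assms by (auto simp: mem_frac frac_pairs_def)
  then show ?thesis unfolding quotient_field_def by (auto dest: * )
qed

lemma quotient_field_is_field: "field (quotient_field R)"
proof -
  let ?K = "quotient_field R"
  have ni: "b \<otimes> d \<in> carrier R - {\<zero>}" if "b \<in> carrier R - {\<zero>}" "d \<in> carrier R - {\<zero>}" for b d
    using that by (auto simp: integral_iff)
  have cr: "cring ?K"
  proof (rule cringI)
    show "abelian_group ?K"
    proof (rule abelian_groupI)
      fix x y z assume x: "x \<in> carrier ?K" and y: "y \<in> carrier ?K" and z: "z \<in> carrier ?K"
      obtain a b where X: "a \<in> carrier R" "b \<in> carrier R - {\<zero>}" "x = frac R a b"
        using x by (rule frac_cases)
      obtain c d where Y: "c \<in> carrier R" "d \<in> carrier R - {\<zero>}" "y = frac R c d"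
        using y by (rule frac_cases)
      obtain e f where Z: "e \<in> carrier R" "f \<in> carrier R - {\<zero>}" "z = frac R e f"
        using z by (rule frac_cases)
      have C: "b \<in> carrier R" "d \<in> carrier R" "f \<in> carrier R" using X Y Z by auto
      show "x \<oplus>\<^bsub>?K\<^esub> y \<in> carrier ?K" using X Y ni by (simp add: frac_add)
      show "x \<oplus>\<^bsub>?K\<^esub> y \<oplus>\<^bsub>?K\<^esub> z = x \<oplus>\<^bsub>?K\<^esub> (y \<oplus>\<^bsub>?K\<^esub> z)"
        unfolding X(3) Y(3) Z(3) using X(1,2) Y(1,2) Z(1,2) C ni
        apply (simp add: frac_add frac_eq_iff) by algebra
      show "x \<oplus>\<^bsub>?K\<^esub> y = y \<oplus>\<^bsub>?K\<^esub> x"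
        unfolding X(3) Y(3) using X(1,2) Y(1,2) C ni
        apply (simp add: frac_add frac_eq_iff) by algebra
      show "\<zero>\<^bsub>?K\<^esub> \<oplus>\<^bsub>?K\<^esub> x = x"
        unfolding X(3) using X(1,2) C ni by (simp add: frac_add frac_eq_iff)
      have "frac R (\<ominus> a) b \<oplus>\<^bsub>?K\<^esub> x = \<zero>\<^bsub>?K\<^esub>"
        unfolding X(3) using X(1,2) C ni
        apply (simp add: frac_add frac_eq_iff) by algebra
      then show "\<exists>y\<in>carrier ?K. y \<oplus>\<^bsub>?K\<^esub> x = \<zero>\<^bsub>?K\<^esub>" using X by (metis a_inv_closed frac_closed)
    qed simp
    show "comm_monoid ?K"
    proof (rule comm_monoidI)
      fix x y z assume x: "x \<in> carrier ?K" and y: "y \<in> carrier ?K" and z: "z \<in> carrier ?K"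
      obtain a b where X: "a \<in> carrier R" "b \<in> carrier R - {\<zero>}" "x = frac R a b"
        using x by (rule frac_cases)
      obtain c d where Y: "c \<in> carrier R" "d \<in> carrier R - {\<zero>}" "y = frac R c d"
        using y by (rule frac_cases)
      obtain e f where Z: "e \<in> carrier R" "f \<in> carrier R - {\<zero>}" "z = frac R e f"
        using z by (rule frac_cases)
      have C: "b \<in> carrier R" "d \<in> carrier R" "f \<in> carrier R" using X Y Z by auto
      show "x \<otimes>\<^bsub>?K\<^esub> y \<in> carrier ?K" using X Y ni by (simp add: frac_mult)
      show "x \<otimes>\<^bsub>?K\<^esub> y \<otimes>\<^bsub>?K\<^esub> z = x \<otimes>\<^bsub>?K\<^esub> (y \<otimes>\<^bsub>?K\<^esub> z)"
        unfolding X(3) Y(3) Z(3) using X(1,2) Y(1,2) Z(1,2) C ni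
        by (simp add: frac_mult m_assoc)
      show "x \<otimes>\<^bsub>?K\<^esub> y = y \<otimes>\<^bsub>?K\<^esub> x"
        unfolding X(3) Y(3) using X(1,2) Y(1,2) C ni by (simp add: frac_mult m_comm)
      show "\<one>\<^bsub>?K\<^esub> \<otimes>\<^bsub>?K\<^esub> x = x"
        unfolding X(3) using X(1,2) C ni by (simp add: frac_mult)
    qed simp
    fix x y z assume x: "x \<in> carrier ?K" and y: "y \<in> carrier ?K" and z: "z \<in> carrier ?K"
    obtain a b where X: "a \<in> carrier R" "b \<in> carrier R - {\<zero>}" "x = frac R a b"
      using x by (rule frac_cases)
    obtain c d where Y: "c \<in> carrier R" "d \<in> carrier R - {\<zero>}" "y = frac R c d"
      using y by (rule frac_cases)
    obtain e f where Z: "e \<in> carrier R" "f \<in> carrier R - {\<zero>}" "z = frac R e f"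
      using z by (rule frac_cases)
    have C: "b \<in> carrier R" "d \<in> carrier R" "f \<in> carrier R" using X Y Z by auto
    show "(x \<oplus>\<^bsub>?K\<^esub> y) \<otimes>\<^bsub>?K\<^esub> z = x \<otimes>\<^bsub>?K\<^esub> z \<oplus>\<^bsub>?K\<^esub> y \<otimes>\<^bsub>?K\<^esub> z"
      unfolding X(3) Y(3) Z(3) using X(1,2) Y(1,2) Z(1,2) C ni
      apply (simp add: frac_add frac_mult frac_eq_iff) by algebra
  qed
  show ?thesis
  proof (rule cring.cring_fieldI2[OF cr])
    show "\<zero>\<^bsub>?K\<^esub> \<noteq> \<one>\<^bsub>?K\<^esub>" by (simp add: frac_eq_iff)
    fix x assume x: "x \<in> carrier ?K" and nz: "x \<noteq> \<zero>\<^bsub>?K\<^esub>"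
    obtain a b where X: "a \<in> carrier R" "b \<in> carrier R - {\<zero>}" "x = frac R a b"
      using x by (rule frac_cases)
    have a: "a \<in> carrier R - {\<zero>}" using nz X by (auto simp: frac_eq_iff)
    have "x \<otimes>\<^bsub>?K\<^esub> frac R b a = \<one>\<^bsub>?K\<^esub>"
      unfolding X(3) using a X(1,2) ni by (simp add: frac_mult frac_eq_iff m_comm)
    moreover have "frac R b a \<in> carrier ?K" using a X(2) by simp
    ultimately show "\<exists>y\<in>carrier ?K. x \<otimes>\<^bsub>?K\<^esub> y = \<one>\<^bsub>?K\<^esub>" by blast
  qed
qed

lemma quotient_field_embedding:
  "(\<lambda>a. frac R a \<one>) \<in> ring_hom R (quotient_field R)" "inj_on (\<lambda>a. frac R a \<one>) (carrier R)"
  by (auto intro!: ring_hom_memI inj_onI simp: frac_add frac_mult frac_eq_iff)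

end


section \<open>Discrete valuations\<close>

definition minimal_prime :: "'a set \<Rightarrow> ('a, 'm) ring_scheme \<Rightarrow> bool" where
  "minimal_prime P R \<longleftrightarrow> primeideal P R \<and> (\<forall>Q. primeideal Q R \<longrightarrow> Q \<subseteq> P \<longrightarrow> Q = P)"

text \<open>
  Only the values of \<open>w\<close> on the nonzero elements matter: the value \<open>\<infinity>\<close> at zero is left implicit.
  Surjectivity normalizes the value group to be all of the integers.
\<close>

definition field_discrete_valuation :: "('k, 'm) ring_scheme \<Rightarrow> ('k \<Rightarrow> int) \<Rightarrow> bool" where
  "field_discrete_valuation K w \<longleftrightarrow>
     (\<forall>x\<in>carrier K - {\<zero>\<^bsub>K\<^esub>}. \<forall>y\<in>carrier K - {\<zero>\<^bsub>K\<^esub>}. w (x \<otimes>\<^bsub>K\<^esub> y) = w x + w y) \<and>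
     (\<forall>x\<in>carrier K - {\<zero>\<^bsub>K\<^esub>}. \<forall>y\<in>carrier K - {\<zero>\<^bsub>K\<^esub>}.
        x \<oplus>\<^bsub>K\<^esub> y \<noteq> \<zero>\<^bsub>K\<^esub> \<longrightarrow> min (w x) (w y) \<le> w (x \<oplus>\<^bsub>K\<^esub> y)) \<and>
     w ` (carrier K - {\<zero>\<^bsub>K\<^esub>}) = UNIV"

definition residue_frac :: "('a, 'm) ring_scheme \<Rightarrow> 'a set \<Rightarrow> 'a \<Rightarrow> ('a set \<times> 'a set) set" where
  \<comment> \<open>the image of a ring element under the map from \<open>R\<close> to the quotient field of \<open>R/P\<close>\<close>
  "residue_frac R P r = frac (R Quot P) (P +>\<^bsub>R\<^esub> r) \<one>\<^bsub>R Quot P\<^esub>"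

text \<open>The range \<open>\<int> \<union> {\<infinity>}\<close> of a discrete valuation of a ring is embedded in \<^typ>\<open>ereal\<close>.\<close>

definition discrete_valuation :: "('a, 'm) ring_scheme \<Rightarrow> ('a \<Rightarrow> ereal) \<Rightarrow> bool" where
  "discrete_valuation R v \<longleftrightarrow>
     (\<exists>P w. minimal_prime P R \<and>
        field_discrete_valuation (quotient_field (R Quot P)) w \<and>
        (\<forall>x\<in>carrier (R Quot P) - {\<zero>\<^bsub>R Quot P\<^esub>}. 0 \<le> w (frac (R Quot P) x \<one>\<^bsub>R Quot P\<^esub>)) \<and>
        (\<forall>r\<in>carrier R. v r = (if r \<in> P then \<infinity> else ereal (of_int (w (residue_frac R P r))))))"

definition valuation_ideal :: "('a, 'm) ring_scheme \<Rightarrow> ('a \<Rightarrow> ereal) \<Rightarrow> real \<Rightarrow> 'a set" where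
  "valuation_ideal R v c = {f \<in> carrier R. ereal c \<le> v f}"


section \<open>Filtrations and their orders\<close>

definition filtration :: "('a, 'm) ring_scheme \<Rightarrow> (nat \<Rightarrow> 'a set) \<Rightarrow> bool" where
  "filtration R I \<longleftrightarrow> (\<forall>m. ideal (I m) R) \<and> I 0 = carrier R \<and> (\<forall>n. I (Suc n) \<subseteq> I n) \<and>
     (\<forall>m n. ideal_prod R (I n) (I m) \<subseteq> I (n + m))"

definition filtration_order :: "(nat \<Rightarrow> 'a set) \<Rightarrow> 'a \<Rightarrow> enat" where
  "filtration_order I f = (SUP m\<in>{m. f \<in> I m}. enat m)"

text \<open>The term at \<open>n = 0\<close> of this sequence is a division by zero and irrelevant to the limit.\<close>

definition asymptotic_samuel :: "('a, 'm) ring_scheme \<Rightarrow> (nat \<Rightarrow> 'a set) \<Rightarrow> 'a \<Rightarrow> ereal" where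
  "asymptotic_samuel R I x =
     lim (\<lambda>n::nat. ereal_of_enat (filtration_order I (x [^]\<^bsub>R\<^esub> n)) / ereal (real n))"

definition discrete_valued_filtration ::
    "('a, 'm) ring_scheme \<Rightarrow> nat \<Rightarrow> (nat \<Rightarrow> 'a \<Rightarrow> ereal) \<Rightarrow> (nat \<Rightarrow> real) \<Rightarrow> nat \<Rightarrow> 'a set" where
  "discrete_valued_filtration R s v a m = (\<Inter>i\<in>{1..s}. valuation_ideal R (v i) (real m * a i))"

definition ereal_floor :: "ereal \<Rightarrow> ereal" where
  "ereal_floor x = (if \<bar>x\<bar> = \<infinity> then x else ereal (of_int \<lfloor>real_of_ereal x\<rfloor>))"


section \<open>Discrete valued filtrations are filtrations\<close>

lemma discrete_valuation_props:
  fixes R (structure)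
  assumes "cring R" "discrete_valuation R v"
  shows discrete_valuation_mult:
      "\<lbrakk>f \<in> carrier R; g \<in> carrier R\<rbrakk> \<Longrightarrow> v (f \<otimes>\<^bsub>R\<^esub> g) = v f + v g"
    and discrete_valuation_add:
      "\<lbrakk>f \<in> carrier R; g \<in> carrier R\<rbrakk> \<Longrightarrow> min (v f) (v g) \<le> v (f \<oplus>\<^bsub>R\<^esub> g)"
    and discrete_valuation_nonneg: "f \<in> carrier R \<Longrightarrow> 0 \<le> v f"
    and discrete_valuation_zero: "v \<zero>\<^bsub>R\<^esub> = \<infinity>"
proof -
  interpret cring R by fact
  obtain P w where mp: "minimal_prime P R"
    and w: "field_discrete_valuation (quotient_field (R Quot P)) w"
    and nn: "\<forall>x\<in>carrier (R Quot P) - {\<zero>\<^bsub>R Quot P\<^esub>}. 0 \<le> w (frac (R Quot P) x \<one>\<^bsub>R Quot P\<^esub>)"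
    and v: "\<And>r. r \<in> carrier R \<Longrightarrow>
      v r = (if r \<in> P then \<infinity> else ereal (of_int (w (residue_frac R P r))))"
    using assms(2) by (auto simp: discrete_valuation_def)
  interpret P: primeideal P R using mp by (simp add: minimal_prime_def)
  interpret D: "domain" "R Quot P" by (rule P.quotient_is_domain)
  let ?K = "quotient_field (R Quot P)"
  have hom: "residue_frac R P \<in> ring_hom R ?K"
    using ring_hom_trans[OF P.rcos_ring_hom D.quotient_field_embedding(1)]
    by (simp add: residue_frac_def[abs_def] o_def)
  have cl: "P +> r \<in> carrier (R Quot P)" if "r \<in> carrier R" for r
    using ring_hom_closed[OF P.rcos_ring_hom that] .
  have Qz: "P +> r = \<zero>\<^bsub>R Quot P\<^esub> \<longleftrightarrow> r \<in> P" if "r \<in> carrier R" for r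
    using that P.rcos_const_imp_mem a_rcos_zero[OF P.ideal_axioms] by (auto simp: FactRing_def)
  have z: "residue_frac R P r = \<zero>\<^bsub>?K\<^esub> \<longleftrightarrow> r \<in> P" if "r \<in> carrier R" for r
    using that cl[OF that] Qz[OF that] by (simp add: residue_frac_def D.frac_eq_iff)
  have kc: "residue_frac R P r \<in> carrier ?K - {\<zero>\<^bsub>?K\<^esub>}" if "r \<in> carrier R" "r \<notin> P" for r
    using that z ring_hom_closed[OF hom] by auto
  show "0 \<le> v f" if "f \<in> carrier R"
    using that nn cl[OF that] Qz[OF that] by (auto simp: v residue_frac_def)
  show "v \<zero> = \<infinity>" by (simp add: v)
  show "v (f \<otimes> g) = v f + v g" if fg: "f \<in> carrier R" "g \<in> carrier R"
  proof (cases "f \<in> P \<or> g \<in> P")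
    case True
    then show ?thesis using fg by (auto simp: v P.I_l_closed P.I_r_closed)
  next
    case False
    then have "f \<otimes> g \<notin> P" using P.I_prime fg by blast
    then show ?thesis using False fg w kc ring_hom_mult[OF hom fg]
      by (simp add: v field_discrete_valuation_def)
  qed
  show "min (v f) (v g) \<le> v (f \<oplus> g)" if fg: "f \<in> carrier R" "g \<in> carrier R"
  proof -
    interpret K: field ?K by (rule D.quotient_field_is_field)
    have h: "residue_frac R P (f \<oplus> g) = residue_frac R P f \<oplus>\<^bsub>?K\<^esub> residue_frac R P g"
      by (rule ring_hom_add[OF hom fg])
    have k: "residue_frac R P f \<in> carrier ?K" "residue_frac R P g \<in> carrier ?K"
      using fg ring_hom_closed[OF hom] by auto
    show ?thesis
    proof (cases "f \<oplus> g \<in> P")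
      case True then show ?thesis using fg by (simp add: v)
    next
      case s: False
      consider "f \<in> P" | "g \<in> P" | "f \<notin> P" "g \<notin> P" by blast
      then show ?thesis
      proof cases
        case 1
        then have "residue_frac R P (f \<oplus> g) = residue_frac R P g"
          using h k z[OF fg(1)] K.l_zero by simp
        moreover have "g \<notin> P" using s 1 P.a_closed by blast
        ultimately show ?thesis using s fg 1 by (simp add: v)
      next
        case 2
        then have "residue_frac R P (f \<oplus> g) = residue_frac R P f"
          using h k z[OF fg(2)] K.r_zero by simp
        moreover have "f \<notin> P" using s 2 P.a_closed by blast
        ultimately show ?thesis using s fg 2 by (simp add: v)
      next
        case 3
        have "min (w (residue_frac R P f)) (w (residue_frac R P g)) \<le> w (residue_frac R P (f \<oplus> g))"
          using w kc[OF fg(1) 3(1)] kc[OF fg(2) 3(2)] kc[OF _ s] fg h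
          unfolding field_discrete_valuation_def by (metis DiffD2 a_closed singletonI)
        then show ?thesis using s 3 fg by (auto simp: v min_def split: if_splits)
      qed
    qed
  qed
qed

lemma filtration_discrete_valued_filtration:
  fixes R (structure)
  assumes R: "cring R" and s: "1 \<le> s"
    and v: "\<And>i. i \<in> {1..s} \<Longrightarrow> discrete_valuation R (v i)"
    and a: "\<And>i. i \<in> {1..s} \<Longrightarrow> 0 < a i"
  shows "filtration R (discrete_valued_filtration R s v a)"
proof -
  interpret cring R by fact
  let ?I = "discrete_valued_filtration R s v a"
  note V = discrete_valuation_props[OF R v]
  have mem: "f \<in> ?I m \<longleftrightarrow> f \<in> carrier R \<and> (\<forall>i\<in>{1..s}. ereal (real m * a i) \<le> v i f)" for f m
    using s by (auto simp: discrete_valued_filtration_def valuation_ideal_def)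
  have addI: "f \<oplus> g \<in> ?I m" if "f \<in> ?I m" "g \<in> ?I m" for f g m
    unfolding mem
  proof safe
    show "f \<oplus> g \<in> carrier R" using that by (auto simp: mem)
    fix i assume i: "i \<in> {1..s}"
    show "ereal (real m * a i) \<le> v i (f \<oplus> g)"
      using V(2)[OF i, of f g] that i by (auto simp: mem intro: order_trans[rotated])
  qed
  have mulI: "f \<otimes> g \<in> ?I (n + m)" if "f \<in> ?I n" "g \<in> ?I m" for f g n m
    unfolding mem
  proof safe
    show "f \<otimes> g \<in> carrier R" using that by (auto simp: mem)
    fix i assume i: "i \<in> {1..s}"
    have "ereal (real n * a i) + ereal (real m * a i) \<le> v i f + v i g"
      using that i by (intro add_mono) (auto simp: mem)
    then show "ereal (real (n + m) * a i) \<le> v i (f \<otimes> g)"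
      using V(1)[OF i, of f g] that by (simp add: mem distrib_right)
  qed
  have I0: "?I 0 = carrier R" using V(3) by (auto simp: mem zero_ereal_def[symmetric])
  have ZI: "\<zero> \<in> ?I m" for m using V(4) by (auto simp: mem)
  have lI: "x \<otimes> f \<in> ?I m" "f \<otimes> x \<in> ?I m" if "f \<in> ?I m" "x \<in> carrier R" for f x m
    using mulI[of x 0 f m] mulI[of f m x 0] that I0 by auto
  have idl: "ideal (?I m) R" for m
  proof (rule idealI)
    show "subgroup (?I m) (add_monoid R)"
    proof (rule add.subgroupI)
      show "?I m \<subseteq> carrier R" by (auto simp: mem)
      show "?I m \<noteq> {}" using ZI by auto
      fix x assume x: "x \<in> ?I m"
      then have "\<ominus> x = \<ominus> \<one> \<otimes> x" by (simp add: mem l_minus)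
      then show "\<ominus> x \<in> ?I m" using lI(1)[OF x, of "\<ominus> \<one>"] by simp
    qed (rule addI)
  qed (use lI in \<open>auto intro: ring_axioms\<close>)
  have dec: "?I (Suc n) \<subseteq> ?I n" for n
  proof
    fix f assume f: "f \<in> ?I (Suc n)"
    have "ereal (real n * a i) \<le> v i f" if i: "i \<in> {1..s}" for i
    proof -
      have "ereal (real n * a i) \<le> ereal (real (Suc n) * a i)"
        using a[OF i] by (simp add: mult_right_mono)
      then show ?thesis using f i by (meson mem order_trans)
    qed
    then show "f \<in> ?I n" using f by (auto simp: mem)
  qed
  have prd: "ideal_prod R (?I n) (?I m) \<subseteq> ?I (n + m)" for n m
  proof
    fix x assume "x \<in> ideal_prod R (?I n) (?I m)"
    then show "x \<in> ?I (n + m)" by induction (auto intro: mulI addI)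
  qed
  show ?thesis unfolding filtration_def using idl I0 dec prd by auto
qed

end

theory Submission
  imports Defs
begin

text \<open>
  Put \<open>M f = min\<^sub>i v\<^sub>i(f)/a\<^sub>i\<close>. Then \<open>f \<in> I\<^sub>m\<close> iff \<open>m \<le> M f\<close>, so the order of \<open>f\<close> is the floor of \<open>M f\<close>.
  As \<open>M (f\<^sup>n) = n M f\<close> for \<open>n \<ge> 1\<close>, the asymptotic Samuel function is the limit of
  \<open>\<lfloor>n M f\<rfloor>/n\<close>, which is \<open>M f\<close>.
\<close>

text \<open>Monotone maps commute with \<open>Min\<close>, so the floor of the minimum will become
  the minimum of the floors.\<close>

lemma mono_ereal_floor: "mono ereal_floor"
proof
  fix x y :: ereal
  assume "x \<le> y"
  then show "ereal_floor x \<le> ereal_floor y"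
    by (cases x; cases y) (auto simp: ereal_floor_def floor_mono)
qed

lemma ereal_of_enat_SUP_le_eq_floor:
  assumes "0 \<le> x"
  shows "ereal_of_enat (SUP m\<in>{m. ereal (real m) \<le> x}. enat m) = ereal_floor x"
proof (cases x)
  case (real r)
  with assms have r: "0 \<le> r" by simp
  have "(SUP m\<in>{m. ereal (real m) \<le> x}. enat m) = enat (nat \<lfloor>r\<rfloor>)"
  proof (rule Sup_eqI)
    show "y \<le> enat (nat \<lfloor>r\<rfloor>)" if "y \<in> enat ` {m. ereal (real m) \<le> x}" for y
      using that real by (auto simp: le_nat_floor)
    \<comment> \<open>The supremum is attained: as \<open>0 \<le> r\<close>, the number
      \<open>nat \<lfloor>r\<rfloor>\<close> itself satisfies the defining inequality.\<close>
    show "enat (nat \<lfloor>r\<rfloor>) \<le> y"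
      if "\<And>z. z \<in> enat ` {m. ereal (real m) \<le> x} \<Longrightarrow> z \<le> y" for y
      using that real r by simp
  qed
  then show ?thesis using real r by (simp add: ereal_floor_def)
next
  case PInf
  \<comment> \<open>A finite supremum \<open>k\<close> would be exceeded by
    \<open>Suc k\<close>.\<close>
  have "(SUP m. enat m) = \<infinity>"
  proof (cases "SUP m. enat m")
    case (enat k)
    have "enat (Suc k) \<le> (SUP m. enat m)" by (rule SUP_upper) simp
    then show ?thesis using enat by simp
  qed
  then show ?thesis using PInf by (simp add: ereal_floor_def)
qed (use assms in simp)

text \<open>For finite \<open>x\<close> this is a squeeze: rounding down costs less than 1, hence
  less than \<open>1 / real n\<close> after division.\<close>

lemma ereal_floor_multiples_tendsto:
  assumes "0 \<le> x"
  shows "(\<lambda>n. ereal_floor (ereal (real n) * x) / ereal (real n)) \<longlonglongrightarrow> x"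
proof (cases x)
  case (real r)
  have lim: "(\<lambda>n. of_int \<lfloor>real n * r\<rfloor> / real n) \<longlonglongrightarrow> r"
  proof (rule tendsto_sandwich)
    have "(\<lambda>n. r - 1 / real n) \<longlonglongrightarrow> r - 0"
      by (intro tendsto_diff tendsto_const lim_1_over_n)
    then show "(\<lambda>n. r - 1 / real n) \<longlonglongrightarrow> r" by simp
    show "\<forall>\<^sub>F n in sequentially. r - 1 / real n \<le> of_int \<lfloor>real n * r\<rfloor> / real n"
      using eventually_gt_at_top[of 0]
    proof eventually_elim
      case (elim n)
      have "r - 1 / real n = (real n * r - 1) / real n"
        using elim by (simp add: field_simps)
      also have "\<dots> \<le> of_int \<lfloor>real n * r\<rfloor> / real n"
        by (rule divide_right_mono) linarith+
      finally show ?case .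
    qed
    show "\<forall>\<^sub>F n in sequentially. of_int \<lfloor>real n * r\<rfloor> / real n \<le> r"
      using eventually_gt_at_top[of 0]
      by eventually_elim (simp add: divide_le_eq mult.commute)
  qed simp
  have "(\<lambda>n. ereal (of_int \<lfloor>real n * r\<rfloor> / real n)) \<longlonglongrightarrow> ereal r"
    using lim by (rule tendsto_ereal)
  moreover have "\<forall>\<^sub>F n in sequentially.
      ereal (of_int \<lfloor>real n * r\<rfloor> / real n) = ereal_floor (ereal (real n) * x) / ereal (real n)"
    using eventually_gt_at_top[of 0]
    by eventually_elim (simp add: real ereal_floor_def)
  ultimately show ?thesis
    unfolding real by (rule Lim_transform_eventually)
next
  case PInf
  \<comment> \<open>The sequence is constant only from \<open>n = 1\<close> on: at
    \<open>n = 0\<close> the convention \<open>0 * \<infinity> = 0\<close> of \<open>ereal\<close>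
    makes the term 0.\<close>
  have "\<forall>\<^sub>F n in sequentially. \<infinity> = ereal_floor (ereal (real n) * x) / ereal (real n)"
    using eventually_gt_at_top[of 0]
    by eventually_elim (simp add: PInf ereal_floor_def)
  then show ?thesis unfolding PInf by (rule Lim_transform_eventually[OF tendsto_const])
qed (use assms in simp)

text \<open>Induction from exponent 1 needs only multiplicativity of \<open>v\<close>, not its value
  at \<open>\<one>\<close>.\<close>

lemma discrete_valuation_pow:
  fixes R (structure)
  assumes "cring R" "discrete_valuation R v" "f \<in> carrier R" "0 < n"
  shows "v (f [^] (n::nat)) = ereal (real n) * v f"
  using assms(4)
proof (induction n rule: nat_induct_non_zero)
  interpret cring R by fact
  case 1
  show ?case using assms(3) by (simp add: one_ereal_def[symmetric])
next
  interpret cring R by fact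
  case (Suc n)
  have "v (f [^] Suc n) = ereal (real n) * v f + v f"
    using Suc assms(3) discrete_valuation_mult[OF assms(1,2)] by simp
  \<comment> \<open>Distributivity is not a general law of \<open>ereal\<close>, so finite and
    infinite values are separated.\<close>
  then show ?case by (cases "v f") (auto simp: algebra_simps)
qed

lemma filtration_order_discrete_valued_filtration:
  fixes R (structure)
  assumes R: "cring R" and s: "1 \<le> s"
    and v: "\<And>i. i \<in> {1..s} \<Longrightarrow> discrete_valuation R (v i)"
    and a: "\<And>i. i \<in> {1..s} \<Longrightarrow> 0 < a i"
    and f: "f \<in> carrier R"
  shows "ereal_of_enat (filtration_order (discrete_valued_filtration R s v a) f) =
    ereal_floor (Min ((\<lambda>i. v i f / ereal (a i)) ` {1..s}))"
proof -
  let ?M = "Min ((\<lambda>i. v i f / ereal (a i)) ` {1..s})"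
  have "0 \<le> ?M"
    using s less_imp_le[OF a] discrete_valuation_nonneg[OF R v f]
    by (simp add: zero_le_divide_ereal)
  moreover have "f \<in> discrete_valued_filtration R s v a m \<longleftrightarrow> ereal (real m) \<le> ?M" for m
  proof -
    \<comment> \<open>Dividing by \<open>a i > 0\<close> preserves the inequality even when
      \<open>v i f\<close> is infinite.\<close>
    have "ereal (real m * a i) \<le> v i f \<longleftrightarrow> ereal (real m) \<le> v i f / ereal (a i)"
      if "i \<in> {1..s}" for i
      using a[OF that] by (simp add: ereal_le_divide_pos mult.commute)
    then show ?thesis
      using s f by (auto simp: discrete_valued_filtration_def valuation_ideal_def)
  qed
  ultimately show ?thesis
    by (simp add: filtration_order_def ereal_of_enat_SUP_le_eq_floor)
qed

theorem lemma1p5: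
  fixes R :: "('a, 'm) ring_scheme"
    and s :: nat
    and v :: "nat \<Rightarrow> 'a \<Rightarrow> ereal"
    and a :: "nat \<Rightarrow> real"
    and f :: 'a
  assumes "cring R"
    and "noetherian_ring R"
    and "1 \<le> s"
    and "\<And>i. i \<in> {1..s} \<Longrightarrow> discrete_valuation R (v i)"
    and "\<And>i. i \<in> {1..s} \<Longrightarrow> 0 < a i"
    and "f \<in> carrier R - {\<zero>\<^bsub>R\<^esub>}"
  shows "ereal_of_enat (filtration_order (discrete_valued_filtration R s v a) f) =
           Min ((\<lambda>i. ereal_floor (v i f / ereal (a i))) ` {1..s})
       \<and> asymptotic_samuel R (discrete_valued_filtration R s v a) f =
           Min ((\<lambda>i. v i f / ereal (a i)) ` {1..s})"
proof
  interpret cring R by fact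
  let ?I = "discrete_valued_filtration R s v a"
  define M where "M g = Min ((\<lambda>i. v i g / ereal (a i)) ` {1..s})" for g
  have f: "f \<in> carrier R" using assms(6) by simp
  have order: "ereal_of_enat (filtration_order ?I g) = ereal_floor (M g)" if "g \<in> carrier R" for g
    unfolding M_def using assms(1,3,4,5) that
    by (rule filtration_order_discrete_valued_filtration)
  show "ereal_of_enat (filtration_order ?I f) =
      Min ((\<lambda>i. ereal_floor (v i f / ereal (a i))) ` {1..s})"
    using order[OF f] assms(3)
    by (simp add: M_def mono_Min_commute[OF mono_ereal_floor] image_image)
  have M_pow: "M (f [^]\<^bsub>R\<^esub> n) = ereal (real n) * M f" if "0 < n" for n :: nat
  proof -
    \<comment> \<open>Scaling by a nonnegative factor is monotone, so it too moves inside
      \<open>Min\<close>.\<close>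
    have "mono (\<lambda>x. ereal (real n) * x)"
      by (intro monoI ereal_mult_left_mono) auto
    from mono_Min_commute[OF this] have "ereal (real n) * M f =
        Min ((\<lambda>i. ereal (real n) * (v i f / ereal (a i))) ` {1..s})"
      using assms(3) by (simp add: M_def image_image)
    also have "(\<lambda>i. ereal (real n) * (v i f / ereal (a i))) ` {1..s} =
        (\<lambda>i. v i (f [^]\<^bsub>R\<^esub> n) / ereal (a i)) ` {1..s}"
      using discrete_valuation_pow[OF assms(1,4) f that]
      by (intro image_cong) (simp_all add: ereal_times_divide_eq)
    finally show ?thesis by (simp add: M_def)
  qed
  have "0 \<le> M f"
    using assms(3) less_imp_le[OF assms(5)] discrete_valuation_nonneg[OF assms(1,4) f]
    by (simp add: M_def zero_le_divide_ereal)
  then have "(\<lambda>n. ereal_floor (ereal (real n) * M f) / ereal (real n)) \<longlonglongrightarrow> M f"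
    by (rule ereal_floor_multiples_tendsto)
  \<comment> \<open>\<open>M_pow\<close> covers positive exponents only, which suffices for a
    limit.\<close>
  moreover have "\<forall>\<^sub>F n in sequentially. ereal_floor (ereal (real n) * M f) / ereal (real n) =
      ereal_of_enat (filtration_order ?I (f [^]\<^bsub>R\<^esub> n)) / ereal (real n)"
    using eventually_gt_at_top[of 0]
    by eventually_elim (simp add: order f M_pow)
  ultimately have "(\<lambda>n. ereal_of_enat (filtration_order ?I (f [^]\<^bsub>R\<^esub> n)) / ereal (real n)) \<longlonglongrightarrow> M f"
    by (rule Lim_transform_eventually)
  \<comment> \<open>\<open>lim\<close> is a description operator; convergence and uniqueness of
    limits determine its value.\<close>
  then show "asymptotic_samuel R ?I f = Min ((\<lambda>i. v i f / ereal (a i)) ` {1..s})"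
    unfolding asymptotic_samuel_def M_def by (rule limI)
qed

end
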